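(* Consider the autonomous system on $\mathbb{R}^5$ with real parameters $C,D,E,F$ $$ \begin{aligned} \dot y_1 &= Cy_1-\big[y_3+\tfrac18(y_1^2+y_2^2+y_4^2+y_5^2)\big]y_2-\tfrac34(y_1y_5-y_2y_4)y_4+2y_2,\\ \dot y_2 &= Cy_2+\big[y_3+\tfrac18(y_1^2+y_2^2+y_4^2+y_5^2)\big]y_1-\tfrac34(y_1y_5-y_2y_4)y_5+2y_1,\\ \dot y_3 &= D(y_1y_2+y_4y_5)+Ey_3+F,\\ \dot y_4 &= Cy_4-\big[y_3+\tfrac18(y_1^2+y_2^2+y_4^2+y_5^2)\big]y_5+\tfrac34(y_1y_5-y_2y_4)y_1+2y_5,\\ \dot y_5 &= Cy_5+\big[y_3+\tfrac18(y_1^2+y_2^2+y_4^2+y_5^2)\big]y_4+\tfrac34(y_1y_5-y_2y_4)y_2+2y_4. \end{aligned} $$ Let $L$ be a limit set of this system. Then any point $\mathbf{y}_0=(y_{10},y_{20},y_{30},y_{40},y_{50})\in L$ satisfies $$y_{10}y_{50}-y_{20}y_{40}=0.$$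
   Context: The system is the averaged model of a spherical pendulum driven by a limited-power electric motor; $C,D,E,F$ are parameters determined by physical and geometric characteristics of the pendulum and the motor ($C$ is a damping parameter). The dot denotes $d/dt$. "Limit set" is understood in the standard sense of the $\omega$-limit set of a solution: for a solution $\mathbf{y}(t)$, $t\ge 0$, it is the set of all points $\mathbf{p}\in\mathbb{R}^5$ such that $\mathbf{y}(t_n)\to\mathbf{p}$ for some sequence $t_n\to+\infty$.
   Formalization: The parameter C is assumed nonzero; for C = 0 the claim fails, e.g. with F = -17E/6 the point (√3, 0, 17/6, 0, 5/√3) is an equilibrium with y1y5 - y2y4 = 5. *)

theory Defs
  imports "HOL-Analysis.Analysis"
begin

(* Coordinates in the type 5 are taken modulo 5, so y $ 5 is the same component as y $ 0;
   the indices 1, ..., 5 are pairwise distinct.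
   Along solutions M' = 2 * C * M. For C = 0 the quantity M is thus a first integral, and it can
   be nonzero on a limit set: with F = -17/6 * E, the point (sqrt 3, 0, 17/6, 0, 5 / sqrt 3) is
   an equilibrium with M = 5. Hence statements that M vanishes on limit sets need C \<noteq> 0. *)
definition pendulum_field :: "real \<Rightarrow> real \<Rightarrow> real \<Rightarrow> real \<Rightarrow> real ^ 5 \<Rightarrow> real ^ 5" where
  "pendulum_field C D E F y =
    (let A = y $ 3 + 1 / 8 * ((y $ 1)\<^sup>2 + (y $ 2)\<^sup>2 + (y $ 4)\<^sup>2 + (y $ 5)\<^sup>2);
         M = y $ 1 * y $ 5 - y $ 2 * y $ 4
     in vector
       [C * y $ 1 - A * y $ 2 - 3 / 4 * M * y $ 4 + 2 * y $ 2,
        C * y $ 2 + A * y $ 1 - 3 / 4 * M * y $ 5 + 2 * y $ 1,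
        D * (y $ 1 * y $ 2 + y $ 4 * y $ 5) + E * y $ 3 + F,
        C * y $ 4 - A * y $ 5 + 3 / 4 * M * y $ 1 + 2 * y $ 5,
        C * y $ 5 + A * y $ 4 + 3 / 4 * M * y $ 2 + 2 * y $ 4])"

(* Only the restriction of y to t >= 0 matters; the derivative at 0 is one-sided. *)
definition is_solution :: "('a::real_normed_vector \<Rightarrow> 'a) \<Rightarrow> (real \<Rightarrow> 'a) \<Rightarrow> bool" where
  "is_solution f y \<longleftrightarrow>
    (\<forall>t\<ge>0. (y has_vector_derivative f (y t)) (at t within {0..}))"

definition omega_limit_set :: "(real \<Rightarrow> 'a::topological_space) \<Rightarrow> 'a set" where
  "omega_limit_set y =
    {p. \<exists>t :: nat \<Rightarrow> real. filterlim t at_top sequentially \<and> (\<lambda>n. y (t n)) \<longlonglongrightarrow> p}"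

definition is_limit_set :: "('a::real_normed_vector \<Rightarrow> 'a) \<Rightarrow> 'a set \<Rightarrow> bool" where
  "is_limit_set f L \<longleftrightarrow> (\<exists>y. is_solution f y \<and> L = omega_limit_set y)"

end

theory Submission
  imports Defs
begin

text \<open>
  The quantity \<open>M = y\<^sub>1 y\<^sub>5 - y\<^sub>2 y\<^sub>4\<close> is the determinant of the two planar vectors
  \<open>(y\<^sub>1, y\<^sub>2)\<close> and \<open>(y\<^sub>4, y\<^sub>5)\<close>. Each of these vectors moves by the same linear map, of trace
  \<open>2 * C\<close>, apart from the terms with the factor \<open>3/4\<close>, whose contributions to \<open>M'\<close> cancel.
  Liouville's formula therefore gives \<open>M' = 2 * C * M\<close> along every solution, whatever the
  motion of \<open>y\<^sub>3\<close>, so \<open>M\<close> is a constant multiple of \<open>exp (2 * C * t)\<close>.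

  For \<open>C < 0\<close> this tends to \<open>0\<close>. For \<open>C > 0\<close> it is unbounded along every sequence of times
  tending to infinity unless it vanishes identically, and unboundedness is impossible along a
  sequence on which the solution converges. In both cases continuity of \<open>M\<close> forces \<open>M = 0\<close> at
  the limit point. This dichotomy is \<open>exponential_observable_zero_on_omega_limit\<close>.
\<close>

lemma linear_scalar_ode_exp:
  fixes g :: "real \<Rightarrow> real"
  assumes der: "\<And>t. t \<ge> 0 \<Longrightarrow> (g has_real_derivative k * g t) (at t within {0..})"
    and "t \<ge> 0"
  shows "g t = g 0 * exp (k * t)"
proof -
  have "((\<lambda>s. g s * exp (- k * s)) has_real_derivative 0) (at s within {0..})"
    if "s \<in> {0..}" for s
    using that by (auto intro!: derivative_eq_intros der)
  then obtain c where "\<And>s. s \<in> {0..} \<Longrightarrow> g s * exp (- k * s) = c"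
    using has_field_derivative_zero_constant[of "{0..}" "\<lambda>s. g s * exp (- k * s)"] by auto
  then have "g t * exp (- k * t) = g 0"
    using \<open>t \<ge> 0\<close> by (metis atLeast_iff exp_zero mult.right_neutral mult_zero_right order_refl)
  then show ?thesis
    by (simp add: exp_minus field_simps)
qed

text \<open>
  Both signs of \<open>k\<close> reduce to one observation: the factor that decays, \<open>exp (k * t)\<close> or its
  inverse, multiplies a quantity that converges along the chosen times. For \<open>k > 0\<close> this kills the
  initial value, for \<open>k < 0\<close> it kills the limit.
\<close>

lemma exponential_observable_zero_on_omega_limit:
  fixes m :: "'a::topological_space \<Rightarrow> real"
  assumes "k \<noteq> 0"
    and cont: "continuous_on UNIV m"
    and der: "\<And>t. t \<ge> 0 \<Longrightarrow>
      ((\<lambda>s. m (y s)) has_real_derivative k * m (y t)) (at t within {0..})"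
    and p: "p \<in> omega_limit_set y"
  shows "m p = 0"
proof -
  from p obtain \<tau> where \<tau>: "filterlim \<tau> at_top sequentially"
    and lim: "(\<lambda>n. y (\<tau> n)) \<longlonglongrightarrow> p"
    by (auto simp: omega_limit_set_def)
  have mlim: "(\<lambda>n. m (y (\<tau> n))) \<longlonglongrightarrow> m p"
    using continuous_on_tendsto_compose[OF cont lim] by simp
  have ev: "\<forall>\<^sub>F n in sequentially. m (y (\<tau> n)) = m (y 0) * exp (k * \<tau> n)"
    using filterlim_at_top[THEN iffD1, OF \<tau>, rule_format, of 0]
    by eventually_elim (rule linear_scalar_ode_exp[OF der])
  have decay: "(\<lambda>n. exp (- \<bar>k\<bar> * \<tau> n)) \<longlonglongrightarrow> 0"
  proof -
    have "filterlim (\<lambda>n. \<bar>k\<bar> * \<tau> n) at_top sequentially"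
      using \<open>k \<noteq> 0\<close> by (intro filterlim_tendsto_pos_mult_at_top[OF tendsto_const _ \<tau>]) simp
    then have "filterlim (\<lambda>n. - (\<bar>k\<bar> * \<tau> n)) at_bot sequentially"
      by (simp add: filterlim_uminus_at_top)
    then show ?thesis
      using filterlim_compose[OF exp_at_bot] by simp
  qed
  show ?thesis
  proof (cases "k > 0")
    case True
    have "(\<lambda>n. m (y (\<tau> n)) * exp (- \<bar>k\<bar> * \<tau> n)) \<longlonglongrightarrow> m p * 0"
      by (rule tendsto_mult[OF mlim decay])
    moreover have "\<forall>\<^sub>F n in sequentially. m (y (\<tau> n)) * exp (- \<bar>k\<bar> * \<tau> n) = m (y 0)"
      using ev by eventually_elim (use True in \<open>simp add: exp_minus\<close>)
    ultimately have "(\<lambda>n. m (y 0)) \<longlonglongrightarrow> 0"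
      by (simp add: tendsto_cong)
    then have "m (y 0) = 0"
      by (simp add: LIMSEQ_const_iff)
    then have "(\<lambda>n. m (y (\<tau> n))) \<longlonglongrightarrow> 0"
      using tendsto_cong[OF ev] by simp
    then show ?thesis
      using mlim LIMSEQ_unique by blast
  next
    case False
    have "(\<lambda>n. m (y 0) * exp (- \<bar>k\<bar> * \<tau> n)) \<longlonglongrightarrow> m (y 0) * 0"
      by (intro tendsto_mult tendsto_const decay)
    then have "(\<lambda>n. m (y (\<tau> n))) \<longlonglongrightarrow> 0"
      using tendsto_cong[OF ev] False by simp
    then show ?thesis
      using mlim LIMSEQ_unique by blast
  qed
qed

lemma vector_5:
  fixes a b c d e :: "'a::zero"
  shows "(vector [a, b, c, d, e] :: 'a ^ 5) $ 1 = a"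
    and "(vector [a, b, c, d, e] :: 'a ^ 5) $ 2 = b"
    and "(vector [a, b, c, d, e] :: 'a ^ 5) $ 3 = c"
    and "(vector [a, b, c, d, e] :: 'a ^ 5) $ 4 = d"
    and "(vector [a, b, c, d, e] :: 'a ^ 5) $ 5 = e"
  by (simp_all add: vector_def)

lemma cross_product_rate_along_pendulum_field:
  assumes sol: "is_solution (pendulum_field C D E F) y" and "t \<ge> 0"
  shows "((\<lambda>s. y s $ 1 * y s $ 5 - y s $ 2 * y s $ 4) has_real_derivative
    2 * C * (y t $ 1 * y t $ 5 - y t $ 2 * y t $ 4)) (at t within {0..})"
proof -
  have comp: "((\<lambda>s. y s $ i) has_real_derivative pendulum_field C D E F (y t) $ i)
      (at t within {0..})" for i
    using sol \<open>t \<ge> 0\<close>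
    by (auto simp: is_solution_def has_real_derivative_iff_has_vector_derivative
        intro!: bounded_linear.has_vector_derivative[OF bounded_linear_vec_nth])
  show ?thesis
    by (rule DERIV_cong[OF DERIV_diff[OF DERIV_mult[OF comp comp] DERIV_mult[OF comp comp]]])
      (simp add: pendulum_field_def Let_def vector_5 algebra_simps)
qed

theorem theorem3p1:
  fixes C D E F :: real and L :: "(real ^ 5) set" and y0 :: "real ^ 5"
  assumes "C \<noteq> 0"
    and "is_limit_set (pendulum_field C D E F) L"
    and "y0 \<in> L"
  shows "y0 $ 1 * y0 $ 5 - y0 $ 2 * y0 $ 4 = 0"
proof -
  from assms obtain y where sol: "is_solution (pendulum_field C D E F) y"
    and y0: "y0 \<in> omega_limit_set y"
    by (auto simp: is_limit_set_def)
  show ?thesis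
  proof (rule exponential_observable_zero_on_omega_limit
      [where k = "2 * C" and m = "\<lambda>z. z $ 1 * z $ 5 - z $ 2 * z $ 4", OF _ _ _ y0])
    show "2 * C \<noteq> 0"
      using \<open>C \<noteq> 0\<close> by simp
    show "continuous_on UNIV (\<lambda>z :: real ^ 5. z $ 1 * z $ 5 - z $ 2 * z $ 4)"
      by (intro continuous_intros)
  qed (rule cross_product_rate_along_pendulum_field[OF sol])
qed

end
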